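(* Let $g\in{\cal H}_d$ with $|a|<1$, where $a=\det Dg$. Let $V\subset{\bf C}^2$ be compact with $K\subset\mathrm{int}\,V$, $g(J^+\cap V)\subset J^+\cap V$ and $g^{-1}(J^-\cap V)\subset J^-\cap V$, and let $s^-=\lim_{n\to\infty}\frac1n\log\max\{\|Dg^{-n}(p)\|:p\in J^-\cap V\}$. Then $$\overline{dim}_B(K^-\cap V)\le 4-\frac{2\log(|a|^{-1})}{s^-}<4.$$
   Context: A generalized Hénon map is a map $g_i(z,w)=(w,P_i(w)+a_iz)$ of ${\bf C}^2$, where $P_i$ is a complex polynomial of degree $d_i\ge 2$ and $a_i\in{\bf C}\setminus\{0\}$. For $d\ge 2$, ${\cal H}_d$ denotes the set of all finite compositions $g=g_1\circ\cdots\circ g_m$ of generalized Hénon maps with $d_1\cdots d_m=d$; $\det Dg$ is constant, equal to $a=a_1\cdots a_m$. $K^\pm$ is the set of points whose forward ($+$) resp. backward ($-$) orbit under $g$ is bounded, $K=K^+\cap K^-$, $J^\pm=\partial K^\pm$. $\overline{dim}_B$ denotes upper box-counting dimension (of a bounded subset of ${\bf C}^2={\bf R}^4$). *)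

theory Defs
  imports "HOL-Analysis.Analysis" "HOL-Computational_Algebra.Polynomial"
begin

text \<open>C^2 is modelled as complex \<times> complex (Euclidean norm on C^2 = R^4).\<close>

definition henon :: "complex poly \<Rightarrow> complex \<Rightarrow> (complex \<times> complex \<Rightarrow> complex \<times> complex)" where
  "henon P c = (\<lambda>(z, w). (w, poly P w + c * z))"

definition henon_comp :: "(complex poly \<times> complex) list \<Rightarrow> (complex \<times> complex \<Rightarrow> complex \<times> complex)" where
  "henon_comp gs = foldr (\<lambda>(P, c) f. henon P c \<circ> f) gs id"

definition henon_data :: "nat \<Rightarrow> (complex poly \<times> complex) list \<Rightarrow> bool" where
  "henon_data d gs \<longleftrightarrow> gs \<noteq> [] \<and> (\<forall>(P, c) \<in> set gs. degree P \<ge> 2 \<and> c \<noteq> 0)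
     \<and> prod_list (map (degree \<circ> fst) gs) = d"

definition Kplus :: "('a \<Rightarrow> 'a::metric_space) \<Rightarrow> 'a set" where
  "Kplus g = {p. bounded (range (\<lambda>n. (g ^^ n) p))}"

definition Kminus :: "('a \<Rightarrow> 'a::metric_space) \<Rightarrow> 'a set" where
  "Kminus g = {p. bounded (range (\<lambda>n. (inv g ^^ n) p))}"

definition Jplus :: "('a \<Rightarrow> 'a::metric_space) \<Rightarrow> 'a set" where
  "Jplus g = frontier (Kplus g)"

definition Jminus :: "('a \<Rightarrow> 'a::metric_space) \<Rightarrow> 'a set" where
  "Jminus g = frontier (Kminus g)"

definition covering_number :: "'a::metric_space set \<Rightarrow> real \<Rightarrow> nat" where
  "covering_number S e = (LEAST k. \<exists>C. finite C \<and> card C = k \<and> S \<subseteq> (\<Union>c\<in>C. ball c e))"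

definition upper_box_dim :: "'a::metric_space set \<Rightarrow> ereal" where
  "upper_box_dim S = Limsup (at_right 0) (\<lambda>e. ereal (ln (real (covering_number S e)) / - ln e))"

end

theory Submission
  imports Defs "HOL-Computational_Algebra.Fundamental_Theorem_Algebra"
begin

text \<open>
  Since \<open>|a| < 1\<close>, the inverse of \<open>g\<close> multiplies volumes by \<open>|a|\<^sup>-\<^sup>2 > 1\<close>. Hence \<open>K\<^sup>-\<close> is a null set,
  so \<open>K\<^sup>- \<subseteq> J\<^sup>-\<close>, and it suffices to treat \<open>A = J\<^sup>- \<inter> V\<close>, which is mapped into itself by the inverse.
  If \<open>\<sigma> > s\<close>, some iterate \<open>g\<^sup>-\<^sup>n\<close> is Lipschitz with constant \<open>exp (n\<sigma>)\<close> near \<open>A\<close>, so that \<open>g\<^sup>-\<^sup>n\<^sup>k\<close> maps the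
  \<open>e\<close>-neighbourhood of \<open>A\<close> into a fixed bounded neighbourhood as long as \<open>exp (nk\<sigma>) e\<close> is small.
  The \<open>e\<close>-neighbourhood therefore has volume at most a constant times \<open>|a|\<^sup>2\<^sup>n\<^sup>k\<close>, which is of order \<open>e\<close> to the power
  \<open>2 log (1/|a|) / \<sigma>\<close>. That \<open>A\<close> is nonempty, without which \<open>s\<close> would be a junk value, follows from
  an escape region argument and the fundamental theorem of algebra.
\<close>

section \<open>Subadditive sequences and box dimension\<close>

lemma subadditive_mult_le:
  fixes u :: "nat \<Rightarrow> real"
  assumes sub: "\<And>m n. u (m + n) \<le> u m + u n"
  shows "u (q * m + r) \<le> real q * u m + u r"
proof (induction q)
  case (Suc q)
  have "u (Suc q * m + r) \<le> u m + u (q * m + r)"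
    using sub[of m "q * m + r"] by (simp add: add.assoc)
  with Suc show ?case by (simp add: algebra_simps)
qed simp

text \<open>Fekete's lemma: the limit is the infimum of the quotients over \<open>n \<ge> 1\<close>,
  which the linear lower bound keeps finite. Division with remainder by a nearly optimal
  \<open>m\<close> gives the upper estimate.\<close>

lemma subadditive_convergent:
  fixes u :: "nat \<Rightarrow> real"
  assumes sub: "\<And>m n. u (m + n) \<le> u m + u n"
    and lower: "\<And>n. c * real n \<le> u n"
  shows "convergent (\<lambda>n. u n / real n)"
proof -
  define I where "I = Inf ((\<lambda>n. u n / real n) ` {1..})"
  have bdd: "bdd_below ((\<lambda>n. u n / real n) ` {1..})"
    by (rule bdd_belowI2[of _ c]) (use lower in \<open>auto simp: field_simps\<close>)
  have "(\<lambda>n. u n / real n) \<longlonglongrightarrow> I"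
  proof (rule order_tendstoI)
    fix y assume "y < I"
    have "y < u n / real n" if "n \<ge> 1" for n
      using cINF_lower[OF bdd, of n] that \<open>y < I\<close> by (simp add: I_def)
    then show "eventually (\<lambda>n. y < u n / real n) sequentially"
      using eventually_ge_at_top[of 1] by (rule eventually_mono[rotated])
  next
    fix y assume "I < y"
    then obtain m where m: "m \<ge> 1" "u m / real m < y"
      using cINF_less_iff[OF _ bdd, of y] by (auto simp: I_def)
    \<comment> \<open>An error bound that serves every \<open>n = q * m + r\<close>: the first term
      pays for replacing \<open>q\<close> by \<open>n / m\<close>, the sum dominates
      \<open>u r\<close> for each possible remainder.\<close>
    define C where "C = \<bar>u m\<bar> + (\<Sum>r<m. \<bar>u r\<bar>)"
    have upper: "u n / real n \<le> u m / real m + C / real n" if n: "n \<ge> 1" for n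
    proof -
      define q r where "q = n div m" and "r = n mod m"
      have nqr: "n = q * m + r" and r: "r < m" using m by (auto simp: q_def r_def)
      have "u r \<le> (\<Sum>r<m. \<bar>u r\<bar>)"
        using r member_le_sum[of r "{..<m}" "\<lambda>r. \<bar>u r\<bar>"] by (simp add: abs_le_iff)
      moreover have "real q * u m \<le> real n * (u m / real m) + \<bar>u m\<bar>"
      proof -
        have "real q * u m = real n * (u m / real m) - (real r / real m) * u m"
          using m nqr by (simp add: field_simps)
        moreover have "(real r / real m) * \<bar>u m\<bar> \<le> 1 * \<bar>u m\<bar>"
          using r m by (intro mult_right_mono) auto
        moreover have "- ((real r / real m) * u m) \<le> (real r / real m) * \<bar>u m\<bar>"
          by (metis abs_ge_minus_self abs_mult abs_of_nonneg divide_nonneg_nonneg of_nat_0_le_iff)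
        ultimately show ?thesis by simp
      qed
      ultimately have "u n \<le> real n * (u m / real m) + C"
        using subadditive_mult_le[of u q m r, OF sub] nqr by (simp add: C_def)
      then show ?thesis using n by (simp add: field_simps)
    qed
    have "(\<lambda>n. u m / real m + C / real n) \<longlonglongrightarrow> u m / real m + 0"
      by (intro tendsto_intros lim_const_over_n)
    then have "eventually (\<lambda>n. u m / real m + C / real n < y) sequentially"
      using m by (intro order_tendstoD) auto
    then show "eventually (\<lambda>n. u n / real n < y) sequentially"
      using eventually_ge_at_top[of 1] by eventually_elim (use upper in \<open>blast intro: le_less_trans\<close>)
  qed
  then show ?thesis by (rule convergentI)
qed

text \<open>Packing against covering: balls of radius \<open>e / 2\<close> around an
  \<open>e\<close>-separated subset are disjoint and lie in the \<open>e\<close>-neighbourhood, so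
  volume limits its size; a separated subset of maximal size already yields a cover by
  \<open>e\<close>-balls.\<close>

lemma covering_number_volume:
  fixes A :: "'a::euclidean_space set"
  assumes e: "e > 0" and V: "V \<ge> 0" and vol: "emeasure lborel (\<Union>p\<in>A. ball p e) \<le> ennreal V"
  shows "real (covering_number A e) * (unit_ball_vol (real DIM('a)) * (e / 2) ^ DIM('a)) \<le> V"
    and "A \<noteq> {} \<Longrightarrow> covering_number A e > 0"
proof -
  define b where "b = unit_ball_vol (real DIM('a)) * (e / 2) ^ DIM('a)"
  have b: "b > 0" using e by (auto simp: b_def)
  define sep where "sep = (\<lambda>F. finite F \<and> F \<subseteq> A \<and> (\<forall>x\<in>F. \<forall>y\<in>F. x \<noteq> y \<longrightarrow> e \<le> dist x y))"
  have card_le: "real (card F) * b \<le> V" if F: "sep F" for F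
  proof -
    have "disjoint_family_on (\<lambda>x. ball x (e / 2)) F"
      unfolding disjoint_family_on_def
    proof (intro ballI impI)
      fix x y assume "x \<in> F" "y \<in> F" "x \<noteq> y"
      then have "e \<le> dist x y" using F by (auto simp: sep_def)
      then show "ball x (e / 2) \<inter> ball y (e / 2) = {}"
        by (intro disjoint_ballI) simp
    qed
    then have "(\<Sum>x\<in>F. emeasure lborel (ball x (e / 2))) = emeasure lborel (\<Union>x\<in>F. ball x (e / 2))"
      using F by (intro sum_emeasure) (auto simp: sep_def)
    also have "\<dots> \<le> emeasure lborel (\<Union>p\<in>A. ball p e)"
      using F e by (intro emeasure_mono) (auto simp: sep_def intro!: borel_open)
    also have "\<dots> \<le> ennreal V" by (rule vol)
    also have "(\<Sum>x\<in>F. emeasure lborel (ball x (e / 2))) = ennreal (real (card F) * b)"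
      using e by (simp add: emeasure_ball b_def ennreal_mult ennreal_of_nat_eq_real_of_nat)
    finally show ?thesis using V by (simp add: ennreal_le_iff)
  qed
  have "sep {}" by (simp add: sep_def)
  moreover have "\<forall>F. sep F \<longrightarrow> card F < Suc (nat \<lceil>V / b\<rceil>)"
  proof (intro allI impI)
    fix F assume "sep F"
    then have "real (card F) \<le> V / b" using card_le b by (simp add: field_simps)
    then show "card F < Suc (nat \<lceil>V / b\<rceil>)" by linarith
  qed
  ultimately have "\<exists>F. sep F \<and> (\<forall>F'. sep F' \<longrightarrow> card F' \<le> card F)"
    by (rule ex_has_greatest_nat[of sep "{}" card "Suc (nat \<lceil>V / b\<rceil>)"])
  then obtain F where F: "sep F" and max: "\<And>F'. sep F' \<Longrightarrow> card F' \<le> card F" by auto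
  have cover: "A \<subseteq> (\<Union>c\<in>F. ball c e)"
  proof (rule ccontr)
    assume "\<not> A \<subseteq> (\<Union>c\<in>F. ball c e)"
    then obtain x where x: "x \<in> A" "\<And>c. c \<in> F \<Longrightarrow> e \<le> dist c x"
      by (auto simp: not_less subset_iff)
    then have "sep (insert x F)" using F by (auto simp: sep_def dist_commute)
    moreover have "x \<notin> F" using x(2)[of x] e by auto
    ultimately show False using max[of "insert x F"] F by (simp add: sep_def)
  qed
  let ?P = "\<lambda>k. \<exists>C. finite C \<and> card C = k \<and> A \<subseteq> (\<Union>c\<in>C. ball c e)"
  have P: "?P (card F)" using F cover by (auto simp: sep_def)
  have "covering_number A e \<le> card F"
    unfolding covering_number_def by (rule Least_le[of ?P, OF P])
  then have "real (covering_number A e) * b \<le> real (card F) * b" using b by simp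
  then show "real (covering_number A e) * (unit_ball_vol (real DIM('a)) * (e / 2) ^ DIM('a)) \<le> V"
    using card_le[OF F] unfolding b_def by (rule order_trans)
  show "covering_number A e > 0" if "A \<noteq> {}"
    using LeastI[of ?P, OF P] that unfolding covering_number_def[symmetric] by (auto simp: card_gt_0_iff)
qed

text \<open>The volume bound makes the covering number at most a constant times
  \<open>e powr (t - d)\<close>. The constant disappears in the limit, since its logarithm is
  divided by \<open>- ln e\<close>, which tends to infinity.\<close>

lemma upper_box_dim_le_volume_growth:
  fixes A :: "'a::euclidean_space set"
  assumes ne: "A \<noteq> {}" and C: "C > 0" and e0: "e0 > 0"
    and vol: "\<And>e. 0 < e \<Longrightarrow> e < e0 \<Longrightarrow> emeasure lborel (\<Union>p\<in>A. ball p e) \<le> ennreal (C * e powr t)"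
  shows "upper_box_dim A \<le> ereal (real DIM('a) - t)"
proof -
  define d where "d = DIM('a)"
  define \<omega> where "\<omega> = unit_ball_vol (real d) / 2 ^ d"
  have \<omega>: "\<omega> > 0" by (simp add: \<omega>_def)
  have bound: "ln (real (covering_number A e)) / - ln e \<le> ln (C / \<omega>) / - ln e + (real d - t)"
    if e: "0 < e" "e < min e0 1" for e
  proof -
    let ?N = "real (covering_number A e)"
    have CV: "0 \<le> C * e powr t" using C by simp
    have N: "?N * (unit_ball_vol (real d) * (e / 2) ^ d) \<le> C * e powr t"
      unfolding d_def using e by (intro covering_number_volume(1)[OF _ CV] vol) auto
    \<comment> \<open>Logarithms are taken next, and \<open>ln 0\<close> would be a default
      value.\<close>
    have pos: "?N > 0"
      using covering_number_volume(2)[OF e(1) CV vol ne] e by simp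
    have "?N * (\<omega> * e ^ d) \<le> C * e powr t"
      using N by (simp add: \<omega>_def power_divide)
    then have "ln (?N * (\<omega> * e ^ d)) \<le> ln (C * e powr t)"
      using pos \<omega> e C by (subst ln_le_cancel_iff) auto
    then have "ln ?N + (ln \<omega> + real d * ln e) \<le> ln C + t * ln e"
      using pos \<omega> e C by (simp add: ln_mult ln_realpow ln_powr)
    then have *: "ln ?N \<le> ln (C / \<omega>) + (real d - t) * (- ln e)"
      using C \<omega> by (simp add: ln_div algebra_simps)
    have "0 < - ln e" using e by simp
    then have "ln ?N / - ln e \<le> (ln (C / \<omega>) + (real d - t) * (- ln e)) / - ln e"
      using * by (intro divide_right_mono) auto
    also have "\<dots> = ln (C / \<omega>) / - ln e + (real d - t)"
      using \<open>0 < - ln e\<close> by (simp add: field_simps)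
    finally show ?thesis .
  qed
  have "filterlim (\<lambda>e::real. - ln e) at_top (at_right 0)"
    using ln_at_0 by (simp add: filterlim_uminus_at_bot)
  then have "((\<lambda>e. ln (C / \<omega>) / - ln e) \<longlongrightarrow> 0) (at_right 0)"
    by (intro tendsto_divide_0[OF tendsto_const] filterlim_at_top_imp_at_infinity)
  then have "((\<lambda>e. ln (C / \<omega>) / - ln e + (real d - t)) \<longlongrightarrow> 0 + (real d - t)) (at_right 0)"
    by (intro tendsto_intros)
  then have lim: "((\<lambda>e. ereal (ln (C / \<omega>) / - ln e + (real d - t))) \<longlongrightarrow> ereal (real d - t)) (at_right 0)"
    by simp
  have "upper_box_dim A \<le> Limsup (at_right 0) (\<lambda>e. ereal (ln (C / \<omega>) / - ln e + (real d - t)))"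
    unfolding upper_box_dim_def
  proof (rule Limsup_mono)
    have "eventually (\<lambda>e. e \<in> {0<..<min e0 1}) (at_right 0)"
      using e0 by (intro eventually_at_right_real) auto
    then show "eventually (\<lambda>e. ereal (ln (real (covering_number A e)) / - ln e)
        \<le> ereal (ln (C / \<omega>) / - ln e + (real d - t))) (at_right 0)"
      by eventually_elim (use bound in auto)
  qed
  also have "\<dots> = ereal (real d - t)"
    by (rule lim_imp_Limsup[OF _ lim]) simp
  finally show ?thesis by (simp add: d_def)
qed

section \<open>Continuously differentiable maps\<close>

text \<open>Derivatives are taken as elements of the normed space of bounded linear maps, so
  continuity refers to the operator norm and passes to \<open>onorm\<close>.\<close>

definition C1_map :: "('a::real_normed_vector \<Rightarrow> 'b::real_normed_vector) \<Rightarrow> bool" where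
  "C1_map f \<longleftrightarrow> (\<exists>f'. (\<forall>p. (f has_derivative blinfun_apply (f' p)) (at p)) \<and> continuous_on UNIV f')"

lemma C1_map_id: "C1_map id"
  unfolding C1_map_def
  by (rule exI[of _ "\<lambda>_. id_blinfun"]) (auto simp: id_def intro!: derivative_eq_intros)

lemma C1_map_comp:
  assumes "C1_map f" "C1_map g"
  shows "C1_map (f \<circ> g)"
proof -
  obtain f' g' where f: "\<And>p. (f has_derivative blinfun_apply (f' p)) (at p)" "continuous_on UNIV f'"
    and g: "\<And>p. (g has_derivative blinfun_apply (g' p)) (at p)" "continuous_on UNIV g'"
    using assms unfolding C1_map_def by blast
  have "continuous_on UNIV g"
    using g(1) by (meson has_derivative_continuous continuous_at_imp_continuous_on)
  then have "continuous_on UNIV (\<lambda>p. f' (g p) o\<^sub>L g' p)"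
    using g(2) f(2) by (auto intro!: continuous_intros continuous_on_compose2[OF f(2)])
  moreover have "(f \<circ> g has_derivative blinfun_apply (f' (g p) o\<^sub>L g' p)) (at p)" for p
    unfolding blinfun_compose.rep_eq by (rule diff_chain_at[OF g(1) f(1)])
  ultimately show ?thesis unfolding C1_map_def
    by (intro exI[of _ "\<lambda>p. f' (g p) o\<^sub>L g' p"]) auto
qed

lemma C1_map_funpow:
  fixes f :: "'a::real_normed_vector \<Rightarrow> 'a"
  shows "C1_map f \<Longrightarrow> C1_map (f ^^ n)"
proof (induction n)
  case (Suc n)
  then have "C1_map (f \<circ> f ^^ n)" by (intro C1_map_comp) auto
  then show ?case by (simp only: funpow.simps)
qed (simp add: C1_map_id)

lemma C1_map_has_derivative:
  "C1_map f \<Longrightarrow> (f has_derivative frechet_derivative f (at p)) (at p)"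
  unfolding C1_map_def by (metis differentiableI frechet_derivative_works)

lemma C1_map_continuous: "C1_map f \<Longrightarrow> continuous_on UNIV f"
  by (meson C1_map_has_derivative has_derivative_continuous continuous_at_imp_continuous_on)

lemma C1_map_continuous_onorm:
  assumes "C1_map f"
  shows "continuous_on UNIV (\<lambda>p. onorm (frechet_derivative f (at p)))"
proof -
  obtain f' where f: "\<And>p. (f has_derivative blinfun_apply (f' p)) (at p)" "continuous_on UNIV f'"
    using assms unfolding C1_map_def by blast
  have "onorm (frechet_derivative f (at p)) = norm (f' p)" for p
    using frechet_derivative_at[OF f(1)] by (simp add: norm_blinfun.rep_eq)
  then show ?thesis using f(2) by (simp add: continuous_on_norm)
qed

text \<open>The strict bound on \<open>A\<close> persists on an open neighbourhood, which by
  compactness contains balls of one common radius around the points of \<open>A\<close>. Balls are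
  convex, so the mean value inequality applies in each.\<close>

lemma C1_map_lipschitz_near_compact:
  fixes f :: "'a::euclidean_space \<Rightarrow> 'b::real_normed_vector"
  assumes f: "C1_map f" and A: "compact A"
    and L: "\<And>p. p \<in> A \<Longrightarrow> onorm (frechet_derivative f (at p)) < L"
  obtains r where "r > 0" "\<And>p x. p \<in> A \<Longrightarrow> x \<in> ball p r \<Longrightarrow> dist (f x) (f p) \<le> L * dist x p"
proof -
  define U where "U = {p. onorm (frechet_derivative f (at p)) < L}"
  have "open U" unfolding U_def
    using open_Collect_less[OF C1_map_continuous_onorm[OF f] continuous_on_const] by simp
  moreover have "A \<subseteq> U" using L by (auto simp: U_def)
  ultimately obtain r where r: "r > 0" "(\<Union>p\<in>A. ball p r) \<subseteq> U"
    by (rule compact_subset_open_imp_ball_epsilon_subset[OF A])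
  have "dist (f x) (f p) \<le> L * dist x p" if "p \<in> A" "x \<in> ball p r" for p x
    unfolding dist_norm
  proof (rule differentiable_bound[OF convex_ball[of p r]])
    show "(f has_derivative frechet_derivative f (at y)) (at y within ball p r)" for y
      using C1_map_has_derivative[OF f] by (rule has_derivative_at_withinI)
    show "onorm (frechet_derivative f (at y)) \<le> L" if "y \<in> ball p r" for y
    proof -
      have "y \<in> U" using r(2) that \<open>p \<in> A\<close> by blast
      then show ?thesis by (simp add: U_def)
    qed
  qed (use that r(1) in auto)
  with r(1) that show ?thesis by blast
qed

section \<open>Volume-expanding maps of a compact set\<close>

text \<open>The one-step estimate is available only within distance \<open>r\<close> of
  \<open>A\<close>. As \<open>L \<ge> 1\<close>, the condition on \<open>L ^ k * e\<close> keeps the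
  orbit of \<open>x\<close> within that range of the orbit of \<open>p\<close> for all
  \<open>k\<close> steps.\<close>

lemma funpow_lipschitz_near:
  fixes h :: "'a::metric_space \<Rightarrow> 'a"
  assumes lip: "\<And>p x. p \<in> A \<Longrightarrow> x \<in> ball p r \<Longrightarrow> dist (h x) (h p) \<le> L * dist x p"
    and inv: "h ` A \<subseteq> A" and L: "L \<ge> 1" and small: "L ^ k * e \<le> r"
    and p: "p \<in> A" and x: "dist x p < e"
  shows "dist ((h ^^ k) x) ((h ^^ k) p) \<le> L ^ k * dist x p"
proof -
  have "j \<le> k \<Longrightarrow> dist ((h ^^ j) x) ((h ^^ j) p) \<le> L ^ j * dist x p" for j
  proof (induction j)
    case (Suc j)
    have "(h ^^ j) p \<in> A" by (induction j) (use p inv in auto)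
    have IH: "dist ((h ^^ j) x) ((h ^^ j) p) \<le> L ^ j * dist x p" using Suc by simp
    also have "L ^ j * dist x p \<le> L ^ k * dist x p"
      using L Suc.prems by (intro mult_right_mono power_increasing) auto
    also have "\<dots> < L ^ k * e" using x L by simp
    finally have "(h ^^ j) x \<in> ball ((h ^^ j) p) r" using small by (simp add: dist_commute)
    then have "dist (h ((h ^^ j) x)) (h ((h ^^ j) p)) \<le> L * dist ((h ^^ j) x) ((h ^^ j) p)"
      by (rule lip[OF \<open>(h ^^ j) p \<in> A\<close>])
    also have "\<dots> \<le> L * (L ^ j * dist x p)" using IH L by (intro mult_left_mono) auto
    finally show ?case by (simp add: mult.assoc)
  qed simp
  then show ?thesis by blast
qed

text \<open>To be used with \<open>G\<close> the inverse of \<open>g\<close>, \<open>A\<close> the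
  part of \<open>Jminus g\<close> in \<open>V\<close>, and \<open>\<rho>\<close> the squared modulus
  of \<open>a\<close>. The volume law speaks of preimages because continuity keeps these Borel, so
  it can be iterated.\<close>

locale volume_expanding =
  fixes G :: "'a::euclidean_space \<Rightarrow> 'a" and A :: "'a set" and \<rho> :: real
  assumes C1: "C1_map G"
    and vol: "S \<in> sets borel \<Longrightarrow> emeasure lborel (G -` S) = ennreal \<rho> * emeasure lborel S"
    and rho_pos: "0 < \<rho>" and rho_less_1: "\<rho> < 1"
    and compact_A: "compact A" and A_nonempty: "A \<noteq> {}" and invariant: "G ` A \<subseteq> A"
begin

definition growth :: "nat \<Rightarrow> real" where
  "growth n = (SUP p\<in>A. onorm (frechet_derivative (G ^^ n) (at p)))"

lemma invariant_funpow: "p \<in> A \<Longrightarrow> (G ^^ n) p \<in> A"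
  by (induction n) (use invariant in auto)

lemma borel_vimage_funpow: "S \<in> sets borel \<Longrightarrow> (G ^^ n) -` S \<in> sets borel"
  using measurable_sets_borel[OF borel_measurable_continuous_onI] C1_map_continuous[OF C1_map_funpow[OF C1]]
  by blast

lemma vol_funpow:
  assumes "S \<in> sets borel"
  shows "emeasure lborel ((G ^^ n) -` S) = ennreal (\<rho> ^ n) * emeasure lborel S"
proof (induction n)
  case (Suc n)
  have "(G ^^ Suc n) -` S = G -` ((G ^^ n) -` S)"
    by (simp add: funpow_Suc_right vimage_comp del: funpow.simps)
  then show ?case
    using Suc vol[OF borel_vimage_funpow[OF assms, of n]] rho_pos
    by (simp add: ennreal_mult mult.assoc del: funpow.simps)
qed simp

text \<open>Ensures that the supremum in \<open>growth\<close> is a genuine least upper bound and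
  not a default value.\<close>

lemma bdd_above_onorm: "bdd_above ((\<lambda>p. onorm (frechet_derivative (G ^^ n) (at p))) ` A)"
  by (intro bounded_imp_bdd_above compact_imp_bounded compact_continuous_image compact_A
      continuous_on_subset[OF C1_map_continuous_onorm[OF C1_map_funpow[OF C1]]]) auto

lemma onorm_le_growth: "p \<in> A \<Longrightarrow> onorm (frechet_derivative (G ^^ n) (at p)) \<le> growth n"
  unfolding growth_def by (rule cSUP_upper[OF _ bdd_above_onorm])

text \<open>A bound on the derivative at a single point bounds the volume expansion of small balls
  around it, which replaces a computation with determinants.\<close>

lemma growth_lower: "exp (real n * (ln (1 / \<rho>) / real DIM('a))) \<le> growth n"
proof (rule dense_ge)
  \<comment> \<open>Room above \<open>growth n\<close> is left because the Lipschitz lemma asks for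
    a strict bound.\<close>
  fix L assume L: "growth n < L"
  obtain p where p: "p \<in> A" using A_nonempty by blast
  have "0 \<le> onorm (frechet_derivative (G ^^ n) (at p))"
    by (rule onorm_pos_le[OF has_derivative_bounded_linear[OF C1_map_has_derivative[OF C1_map_funpow[OF C1]]]])
  then have Lpos: "0 < L" using onorm_le_growth[OF p, of n] L by simp
  obtain r where r: "r > 0" "\<And>q x. q \<in> A \<Longrightarrow> x \<in> ball q r \<Longrightarrow> dist ((G ^^ n) x) ((G ^^ n) q) \<le> L * dist x q"
    by (rule C1_map_lipschitz_near_compact[OF C1_map_funpow[OF C1, of n] compact_A, of L])
      (use le_less_trans[OF onorm_le_growth L] in auto)
  define \<omega> where "\<omega> = unit_ball_vol (real DIM('a))"
  have \<omega>: "\<omega> > 0" by (simp add: \<omega>_def)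
  \<comment> \<open>Comparing volumes in this inclusion cancels \<open>r\<close> and leaves
    \<open>1 \<le> \<rho> ^ n * L ^ DIM('a)\<close>.\<close>
  have "ball p r \<subseteq> (G ^^ n) -` ball ((G ^^ n) p) (L * r)"
  proof
    fix x assume x: "x \<in> ball p r"
    have "dist ((G ^^ n) x) ((G ^^ n) p) \<le> L * dist x p" by (rule r(2)[OF p x])
    also have "\<dots> < L * r" using x Lpos by (simp add: dist_commute)
    finally show "x \<in> (G ^^ n) -` ball ((G ^^ n) p) (L * r)" by (simp add: dist_commute)
  qed
  then have "emeasure lborel (ball p r) \<le> emeasure lborel ((G ^^ n) -` ball ((G ^^ n) p) (L * r))"
    by (intro emeasure_mono) (simp_all add: borel_vimage_funpow)
  also have "\<dots> = ennreal (\<rho> ^ n) * emeasure lborel (ball ((G ^^ n) p) (L * r))"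
    by (intro vol_funpow) simp
  finally have "ennreal (\<omega> * r ^ DIM('a)) \<le> ennreal (\<rho> ^ n * (\<omega> * (L * r) ^ DIM('a)))"
    using r(1) Lpos rho_pos \<omega> by (simp add: emeasure_ball \<omega>_def ennreal_mult)
  then have "\<omega> * r ^ DIM('a) \<le> \<rho> ^ n * (\<omega> * (L * r) ^ DIM('a))"
    using r(1) Lpos rho_pos \<omega> by (subst (asm) ennreal_le_iff) auto
  then have "1 * (\<omega> * r ^ DIM('a)) \<le> (\<rho> ^ n * L ^ DIM('a)) * (\<omega> * r ^ DIM('a))"
    by (simp add: power_mult_distrib mult_ac)
  then have "1 \<le> \<rho> ^ n * L ^ DIM('a)"
    using \<omega> r(1) by (subst (asm) mult_le_cancel_right_pos) auto
  then have "ln 1 \<le> ln (\<rho> ^ n * L ^ DIM('a))"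
    using Lpos rho_pos by (subst ln_le_cancel_iff) auto
  then have "real n * ln (1 / \<rho>) \<le> real DIM('a) * ln L"
    using Lpos rho_pos by (simp add: ln_mult ln_realpow ln_div)
  then have "real n * (ln (1 / \<rho>) / real DIM('a)) \<le> ln L"
    by (simp add: field_simps)
  then show "exp (real n * (ln (1 / \<rho>) / real DIM('a))) \<le> L"
    using Lpos by (metis exp_le_cancel_iff exp_ln)
qed

section \<open>Submultiplicativity and the exponential growth rate of the derivatives\<close>

lemma growth_pos: "growth n > 0"
  using growth_lower[of n] by (rule less_le_trans[OF exp_gt_zero])

text \<open>Chain rule and submultiplicativity of the operator norm; invariance of \<open>A\<close>
  lets the outer derivative, taken at \<open>(G ^^ n) p\<close>, be bounded by
  \<open>growth m\<close>.\<close>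

lemma growth_add: "growth (m + n) \<le> growth m * growth n"
  unfolding growth_def[of "m + n"]
proof (rule cSUP_least[OF A_nonempty])
  fix p assume p: "p \<in> A"
  have D: "((G ^^ k) has_derivative frechet_derivative (G ^^ k) (at q)) (at q)" for k q
    by (rule C1_map_has_derivative[OF C1_map_funpow[OF C1]])
  have "(G ^^ (m + n) has_derivative
      frechet_derivative (G ^^ m) (at ((G ^^ n) p)) \<circ> frechet_derivative (G ^^ n) (at p)) (at p)"
    unfolding funpow_add by (rule diff_chain_at[OF D D])
  then have "onorm (frechet_derivative (G ^^ (m + n)) (at p))
      = onorm (frechet_derivative (G ^^ m) (at ((G ^^ n) p)) \<circ> frechet_derivative (G ^^ n) (at p))"
    using frechet_derivative_at by metis
  also have "\<dots> \<le> onorm (frechet_derivative (G ^^ m) (at ((G ^^ n) p))) * onorm (frechet_derivative (G ^^ n) (at p))"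
    by (intro onorm_compose has_derivative_bounded_linear[OF D])
  also have "\<dots> \<le> growth m * growth n"
    using growth_pos[of m] onorm_pos_le[OF has_derivative_bounded_linear[OF D]]
    by (intro mult_mono onorm_le_growth invariant_funpow p) (auto intro: less_imp_le)
  finally show "onorm (frechet_derivative (G ^^ (m + n)) (at p)) \<le> growth m * growth n" .
qed

text \<open>Has the shape of the expression for \<open>s\<close> in the theorem, so that the two
  agree by unfolding.\<close>

definition rate :: real where
  "rate = lim (\<lambda>n. (1 / real n) * ln (growth n))"

lemma ln_growth_lower: "(ln (1 / \<rho>) / real DIM('a)) * real n \<le> ln (growth n)"
  using growth_lower[of n] growth_pos[of n] by (simp add: ln_ge_iff mult.commute)

text \<open>Fekete's lemma applied to \<open>ln (growth n)\<close>; it certifies that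
  \<open>lim\<close> in \<open>rate\<close> denotes an actual limit.\<close>

lemma rate_limit: "(\<lambda>n. ln (growth n) / real n) \<longlonglongrightarrow> rate"
proof -
  have "convergent (\<lambda>n. ln (growth n) / real n)"
  proof (rule subadditive_convergent)
    show "ln (growth (m + n)) \<le> ln (growth m) + ln (growth n)" for m n
    proof -
      have "ln (growth (m + n)) \<le> ln (growth m * growth n)"
        using growth_add[of m n] growth_pos by (subst ln_le_cancel_iff) auto
      then show ?thesis using growth_pos[of m] growth_pos[of n] by (simp add: ln_mult)
    qed
  qed (rule ln_growth_lower)
  then show ?thesis by (simp add: convergent_LIMSEQ_iff rate_def)
qed

lemma ln_inverse_rho_pos: "ln (1 / \<rho>) > 0"
  using rho_pos rho_less_1 by simp

lemma rate_pos: "rate > 0"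
proof -
  have "ln (1 / \<rho>) / real DIM('a) \<le> rate"
  proof (rule tendsto_lowerbound[OF rate_limit])
    show "\<forall>\<^sub>F n in sequentially. ln (1 / \<rho>) / real DIM('a) \<le> ln (growth n) / real n"
      using eventually_ge_at_top[of 1]
    proof eventually_elim
      case (elim n)
      then show ?case using ln_growth_lower[of n] by (simp add: pos_le_divide_eq)
    qed
  qed simp
  moreover have "0 < ln (1 / \<rho>) / real DIM('a)" using ln_inverse_rho_pos by simp
  ultimately show ?thesis by linarith
qed

text \<open>At scale \<open>e\<close>, the map \<open>G ^^ n\<close> is iterated as often as the
  Lipschitz estimate permits; each round gains a factor \<open>\<rho> ^ n\<close> in volume.\<close>

lemma neighbourhood_volume:
  assumes "rate < \<sigma>"
  obtains C e0 where "C > 0" "e0 > 0"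
    "\<And>e. 0 < e \<Longrightarrow> e < e0 \<Longrightarrow>
      emeasure lborel (\<Union>p\<in>A. ball p e) \<le> ennreal (C * e powr (ln (1 / \<rho>) / \<sigma>))"
proof -
  have \<sigma>: "\<sigma> > 0" using assms rate_pos by simp
  define l where "l = ln (1 / \<rho>)"
  have l: "l > 0" using ln_inverse_rho_pos by (simp add: l_def)
  have rho: "\<rho> = exp (- l)" using rho_pos by (simp add: l_def ln_div)
  have "eventually (\<lambda>n. ln (growth n) / real n < \<sigma>) sequentially"
    by (rule order_tendstoD(2)[OF rate_limit assms])
  then have "eventually (\<lambda>n. n \<ge> 1 \<and> ln (growth n) / real n < \<sigma>) sequentially"
    using eventually_ge_at_top[of 1] by eventually_elim simp
  then obtain n where n: "n \<ge> 1" "ln (growth n) / real n < \<sigma>"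
    using eventually_happens'[OF sequentially_bot] by blast
  define L where "L = exp (real n * \<sigma>)"
  have L1: "L \<ge> 1" using \<sigma> by (simp add: L_def)
  have "ln (growth n) < real n * \<sigma>" using n by (simp add: field_simps)
  then have growth_L: "growth n < L"
    unfolding L_def using growth_pos[of n] by (metis exp_less_cancel_iff exp_ln)
  obtain r where r: "r > 0"
    "\<And>p x. p \<in> A \<Longrightarrow> x \<in> ball p r \<Longrightarrow> dist ((G ^^ n) x) ((G ^^ n) p) \<le> L * dist x p"
    by (rule C1_map_lipschitz_near_compact[OF C1_map_funpow[OF C1, of n] compact_A, of L])
      (use le_less_trans[OF onorm_le_growth growth_L] in auto)
  define U where "U = (\<Union>p\<in>A. ball p r)"
  have U_borel: "U \<in> sets borel" unfolding U_def by (intro borel_open open_UN) auto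
  obtain M where M: "M > 0" "emeasure lborel U \<le> ennreal M"
  proof -
    obtain B where B: "\<And>p. p \<in> A \<Longrightarrow> norm p \<le> B"
      using compact_imp_bounded[OF compact_A] unfolding bounded_iff by blast
    have "norm x \<le> B + r" if x: "x \<in> U" for x
    proof -
      obtain p where "p \<in> A" "dist p x < r" using x by (auto simp: U_def)
      then show ?thesis using B[of p] norm_triangle_ineq3[of x p]
        by (simp add: dist_norm norm_minus_commute)
    qed
    then have "bounded U" unfolding bounded_iff by blast
    then have "emeasure lborel U < \<infinity>" by (rule emeasure_bounded_finite)
    then have "emeasure lborel U = ennreal (measure lborel U)"
      by (intro emeasure_eq_ennreal_measure) auto
    then show ?thesis by (intro that[of "measure lborel U + 1"]) (auto simp: add_nonneg_pos intro: ennreal_leI)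
  qed
  \<comment> \<open>The term \<open>l * real n\<close> pays for rounding the number of rounds down,
    and the term with \<open>ln r\<close> for starting from radius \<open>r\<close> instead of
    \<open>1\<close>.\<close>
  define C where "C = M * exp (l * real n - l / \<sigma> * ln r)"
  have "emeasure lborel (\<Union>p\<in>A. ball p e) \<le> ennreal (C * e powr (l / \<sigma>))" if e: "0 < e" "e < r" for e
  proof -
    \<comment> \<open>The real number of rounds at which \<open>e\<close> would have grown exactly
      to \<open>r\<close>; its integer part \<open>k\<close> is the largest admissible number of
      rounds.\<close>
    define y where "y = ln (r / e) / (real n * \<sigma>)"
    have y: "y \<ge> 0" using e n \<sigma> by (simp add: y_def)
    define k where "k = nat \<lfloor>y\<rfloor>"
    have k: "real k \<le> y" "y < real k + 1" using y by (auto simp: k_def)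
    have "L ^ k = exp (real k * (real n * \<sigma>))" by (simp add: L_def exp_of_nat_mult)
    also have "\<dots> \<le> exp (y * (real n * \<sigma>))" using k(1) \<sigma> by (simp add: mult_right_mono)
    also have "\<dots> = r / e" using n \<sigma> e by (simp add: y_def)
    finally have small: "L ^ k * e \<le> r" using e by (simp add: field_simps)
    have pow: "((G ^^ n) ^^ k) = G ^^ (n * k)" by (simp add: funpow_mult mult.commute)
    have "(\<Union>p\<in>A. ball p e) \<subseteq> (G ^^ (n * k)) -` U"
    proof
      fix x assume "x \<in> (\<Union>p\<in>A. ball p e)"
      then obtain p where p: "p \<in> A" "dist x p < e" by (auto simp: dist_commute)
      have "dist (((G ^^ n) ^^ k) x) (((G ^^ n) ^^ k) p) \<le> L ^ k * dist x p"
        using invariant_funpow by (intro funpow_lipschitz_near[OF r(2) _ L1 small p]) auto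
      also have "\<dots> < L ^ k * e" using p L1 by simp
      finally have "dist ((G ^^ (n * k)) p) ((G ^^ (n * k)) x) < r"
        using small by (simp add: pow dist_commute)
      then show "x \<in> (G ^^ (n * k)) -` U"
        using invariant_funpow[OF p(1)] by (auto simp: U_def)
    qed
    then have "emeasure lborel (\<Union>p\<in>A. ball p e) \<le> emeasure lborel ((G ^^ (n * k)) -` U)"
      by (intro emeasure_mono) (simp_all add: borel_vimage_funpow U_borel)
    also have "\<dots> = ennreal (\<rho> ^ (n * k)) * emeasure lborel U" by (rule vol_funpow[OF U_borel])
    also have "\<dots> \<le> ennreal (\<rho> ^ (n * k)) * ennreal M" by (intro mult_left_mono M) simp
    also have "\<dots> = ennreal (\<rho> ^ (n * k) * M)" using M rho_pos by (simp add: ennreal_mult)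
    also have "\<dots> \<le> ennreal (C * e powr (l / \<sigma>))"
    proof (rule ennreal_leI)
      \<comment> \<open>Rounding loses less than one round, that is, a factor of at most
        \<open>exp (l * n)\<close> in the volume.\<close>
      have "real n * y \<le> real n * (real k + 1)" using k(2) by (intro mult_left_mono) auto
      moreover have "real n * y = (ln r - ln e) / \<sigma>"
        using n \<sigma> e r(1) by (simp add: y_def ln_div)
      ultimately have "l * ((ln r - ln e) / \<sigma>) \<le> l * (real n * (real k + 1))"
        using l by (intro mult_left_mono) auto
      then have expo: "real (n * k) * (- l) \<le> (l * real n - l / \<sigma> * ln r) + l / \<sigma> * ln e"
        by (simp add: algebra_simps diff_divide_distrib)
      have "\<rho> ^ (n * k) * M = exp (real (n * k) * (- l)) * M"
        unfolding rho by (simp only: exp_of_nat_mult)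
      also have "\<dots> \<le> exp ((l * real n - l / \<sigma> * ln r) + l / \<sigma> * ln e) * M"
        using expo M(1) by (intro mult_right_mono) auto
      also have "\<dots> = C * e powr (l / \<sigma>)"
        unfolding exp_add using e by (simp add: C_def powr_def mult_ac)
      finally show "\<rho> ^ (n * k) * M \<le> C * e powr (l / \<sigma>)" .
    qed
    finally show ?thesis .
  qed
  then show ?thesis using that[of C r] M(1) r(1) by (simp add: C_def l_def)
qed

text \<open>The volume estimate for \<open>A\<close> passes to its subset \<open>B\<close> by
  monotonicity of measure. The bound holds for every \<open>\<sigma>\<close> above
  \<open>rate\<close>, and \<open>\<sigma>\<close> then decreases to \<open>rate\<close>, which is
  positive.\<close>

theorem upper_box_dim_le:
  assumes B: "B \<subseteq> A" "B \<noteq> {}"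
  shows "upper_box_dim B \<le> ereal (real DIM('a) - ln (1 / \<rho>) / rate)"
proof -
  have bound: "upper_box_dim B \<le> ereal (real DIM('a) - ln (1 / \<rho>) / \<sigma>)" if \<sigma>: "rate < \<sigma>" for \<sigma>
  proof -
    obtain C e0 where C: "C > 0" "e0 > 0" and vol: "\<And>e. 0 < e \<Longrightarrow> e < e0 \<Longrightarrow>
        emeasure lborel (\<Union>p\<in>A. ball p e) \<le> ennreal (C * e powr (ln (1 / \<rho>) / \<sigma>))"
      using neighbourhood_volume[OF \<sigma>] by blast
    show ?thesis
    proof (rule upper_box_dim_le_volume_growth[OF B(2) C])
      fix e :: real assume e: "0 < e" "e < e0"
      have "emeasure lborel (\<Union>p\<in>B. ball p e) \<le> emeasure lborel (\<Union>p\<in>A. ball p e)"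
        using B(1) by (intro emeasure_mono) (auto intro!: borel_open)
      also note vol[OF e]
      finally show "emeasure lborel (\<Union>p\<in>B. ball p e) \<le> ennreal (C * e powr (ln (1 / \<rho>) / \<sigma>))" .
    qed
  qed
  have "((\<lambda>\<sigma>. real DIM('a) - ln (1 / \<rho>) / \<sigma>) \<longlongrightarrow> real DIM('a) - ln (1 / \<rho>) / rate) (at_right rate)"
    using rate_pos by (intro tendsto_intros) auto
  then have "((\<lambda>\<sigma>. ereal (real DIM('a) - ln (1 / \<rho>) / \<sigma>)) \<longlongrightarrow> ereal (real DIM('a) - ln (1 / \<rho>) / rate)) (at_right rate)"
    by (simp only: tendsto_ereal)
  then show ?thesis
  proof (rule tendsto_lowerbound)
    show "\<forall>\<^sub>F \<sigma> in at_right rate. upper_box_dim B \<le> ereal (real DIM('a) - ln (1 / \<rho>) / \<sigma>)"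
      using eventually_at_right_less[of rate] by eventually_elim (rule bound)
  qed simp
qed

end

section \<open>Volume distortion and smoothness of Henon maps\<close>

text \<open>Transfers planar volume to \<open>real^2\<close>, where the determinant formula for
  linear images is applied to complex multiplication.\<close>

lemma lborel_complex_eq_distr_vec2:
  "(lborel :: complex measure) = distr (lborel :: (real^2) measure) borel (\<lambda>x. Complex (x $ 1) (x $ 2))"
proof (rule lborel_eqI)
  fix l u :: complex assume "\<And>b. b \<in> Basis \<Longrightarrow> l \<bullet> b \<le> u \<bullet> b"
  from this[of 1] this[of \<i>] have le: "Re l \<le> Re u" "Im l \<le> Im u"
    by (auto simp: Basis_complex_def)
  have eq: "(\<lambda>x::real^2. Complex (x $ 1) (x $ 2)) -` box l u
      = box (vector [Re l, Im l]) (vector [Re u, Im u])"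
    by (auto simp: mem_box Basis_complex_def Basis_vec_def inner_axis UNIV_2)
  have [measurable]: "(\<lambda>x::real^2. Complex (x $ 1) (x $ 2)) \<in> borel \<rightarrow>\<^sub>M borel"
    by (intro borel_measurable_continuous_onI) (auto simp: Complex_eq intro!: continuous_intros)
  have "emeasure lborel (box (vector [Re l, Im l]) (vector [Re u, Im u]) :: (real^2) set)
      = ennreal ((Re u - Re l) * (Im u - Im l))"
    using le by (auto simp: emeasure_lborel_box_eq Basis_vec_def inner_axis UNIV_2 axis_eq_axis algebra_simps)
  with eq show "emeasure (distr lborel borel (\<lambda>x::real^2. Complex (x $ 1) (x $ 2))) (box l u)
      = ennreal (\<Prod>b\<in>Basis. (u - l) \<bullet> b)"
    by (simp add: emeasure_distr Basis_complex_def complex_eq_iff)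
qed simp

text \<open>The preimage under multiplication by \<open>c\<close> is the image under multiplication
  by \<open>1 / c\<close>, which in real coordinates is the linear map \<open>f\<close> of
  determinant \<open>(norm e)\<^sup>2\<close>.\<close>

lemma emeasure_lborel_complex_mult_box:
  fixes c l u :: complex
  assumes "c \<noteq> 0"
  shows "ennreal ((norm c)\<^sup>2) * emeasure lborel ((*) c -` box l u) = emeasure lborel (box l u)"
proof -
  define \<phi> :: "real^2 \<Rightarrow> complex" where "\<phi> = (\<lambda>x. Complex (x $ 1) (x $ 2))"
  define e where "e = inverse c"
  define f :: "real^2 \<Rightarrow> real^2" where
    "f = (\<lambda>x. vector [Re e * x $ 1 - Im e * x $ 2, Im e * x $ 1 + Re e * x $ 2])"
  have lin: "linear f"
    by (rule linearI) (auto simp: f_def vec_eq_iff forall_2 algebra_simps)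
  have det: "det (matrix f) = (norm e)\<^sup>2"
    by (simp add: det_2 matrix_def f_def axis_def cmod_power2) (simp add: power2_eq_square)
  have [measurable]: "\<phi> \<in> borel \<rightarrow>\<^sub>M borel" unfolding \<phi>_def
    by (intro borel_measurable_continuous_onI) (auto simp: Complex_eq intro!: continuous_intros)
  have \<phi>f: "\<phi> (f x) = e * \<phi> x" for x
    by (auto simp: \<phi>_def f_def complex_eq_iff)
  have inj: "x = y" if "\<phi> x = \<phi> y" for x y
    using that by (auto simp: \<phi>_def vec_eq_iff forall_2)
  have sur: "\<exists>x. \<phi> x = z" for z
    by (rule exI[of _ "vector [Re z, Im z]"]) (simp add: \<phi>_def complex_eq_iff)
  define Y where "Y = \<phi> -` box l u"
  have Y: "Y = box (vector [Re l, Im l]) (vector [Re u, Im u])"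
    by (auto simp: Y_def \<phi>_def mem_box Basis_complex_def Basis_vec_def inner_axis UNIV_2)
  have X: "\<phi> -` ((*) c -` box l u) = f ` Y"
  proof (intro set_eqI iffI)
    fix x assume x: "x \<in> \<phi> -` ((*) c -` box l u)"
    obtain y where y: "\<phi> y = c * \<phi> x" using sur by blast
    then have "y \<in> Y" using x by (simp add: Y_def)
    moreover have "\<phi> (f y) = \<phi> x" using assms by (simp add: \<phi>f y e_def)
    ultimately show "x \<in> f ` Y" using inj by blast
  next
    have ce: "c * (e * z) = z" for z using assms by (simp add: e_def field_simps)
    fix x assume "x \<in> f ` Y"
    then show "x \<in> \<phi> -` ((*) c -` box l u)"
      by (auto simp: \<phi>f Y_def ce)
  qed
  have Ym: "Y \<in> lmeasurable" by (simp add: Y)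
  have fY: "f ` Y \<in> lmeasurable" "measure lebesgue (f ` Y) = (norm e)\<^sup>2 * measure lebesgue Y"
    using measurable_linear_image[OF lin Ym] measure_linear_image[OF lin Ym] det by auto
  have cb: "(*) c -` box l u \<in> sets borel"
    by (intro borel_open open_vimage open_box continuous_intros)
  then have fYb: "f ` Y \<in> sets borel"
    using measurable_sets[OF \<open>\<phi> \<in> _\<close> cb] X by simp
  have "emeasure lborel ((*) c -` box l u) = emeasure lborel (f ` Y)"
    by (subst lborel_complex_eq_distr_vec2)
      (use cb X in \<open>simp add: emeasure_distr flip: \<phi>_def\<close>)
  also have "\<dots> = emeasure lebesgue (f ` Y)"
    using fYb by (simp add: emeasure_completion)
  also have "\<dots> = ennreal ((norm e)\<^sup>2 * measure lebesgue Y)"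
    using fY by (simp add: emeasure_eq_measure2)
  finally have 1: "emeasure lborel ((*) c -` box l u) = ennreal ((norm e)\<^sup>2 * measure lebesgue Y)" .
  have "emeasure lborel (box l u) = emeasure lborel Y"
    by (subst lborel_complex_eq_distr_vec2)
      (simp add: emeasure_distr Y_def flip: \<phi>_def)
  also have "\<dots> = emeasure lebesgue Y" by (simp add: Y)
  also have "\<dots> = ennreal (measure lebesgue Y)" using Ym by (simp add: emeasure_eq_measure2)
  finally have 2: "emeasure lborel (box l u) = ennreal (measure lebesgue Y)" .
  show ?thesis unfolding 1 2 using assms
    by (simp add: e_def norm_inverse ennreal_mult'[symmetric] power_inverse)
qed

text \<open>An identity of measures needs checking on boxes only, and so carries the box computation
  to all Borel sets. Translation invariance accounts for \<open>b\<close>.\<close>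

lemma lborel_complex_affine:
  fixes b c :: complex
  assumes "c \<noteq> 0"
  shows "lborel = density (distr lborel borel (\<lambda>z. b + c * z)) (\<lambda>_. ennreal ((norm c)\<^sup>2))"
proof -
  have m [measurable]: "(*) c \<in> borel \<rightarrow>\<^sub>M borel"
    by (intro borel_measurable_continuous_onI continuous_intros)
  have mult: "lborel = density (distr lborel borel ((*) c)) (\<lambda>_. ennreal ((norm c)\<^sup>2))"
  proof (rule lborel_eqI)
    fix l u :: complex assume "\<And>b. b \<in> Basis \<Longrightarrow> l \<bullet> b \<le> u \<bullet> b"
    then show "emeasure (density (distr lborel borel ((*) c)) (\<lambda>_. ennreal ((norm c)\<^sup>2))) (box l u)
        = ennreal (\<Prod>b\<in>Basis. (u - l) \<bullet> b)"
      using emeasure_lborel_complex_mult_box[OF assms, of l u]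
      by (simp add: emeasure_density emeasure_distr nn_integral_cmult_indicator emeasure_lborel_box_eq)
  qed simp
  have "lborel = distr lborel borel ((+) b)"
    by (rule lborel_distr_plus[symmetric])
  also have "\<dots> = distr (density (distr lborel borel ((*) c)) (\<lambda>_. ennreal ((norm c)\<^sup>2))) borel ((+) b)"
    using mult by simp
  also have "\<dots> = density (distr lborel borel (\<lambda>z. b + c * z)) (\<lambda>_. ennreal ((norm c)\<^sup>2))"
    by (rule measure_eqI)
      (auto simp: emeasure_distr emeasure_density nn_integral_cmult_indicator vimage_def
         measurable_sets_borel[OF m, unfolded vimage_def])
  finally show ?thesis .
qed

lemma emeasure_lborel_complex_affine_vimage:
  fixes b c :: complex
  assumes "c \<noteq> 0" and [measurable]: "S \<in> sets borel"
  shows "ennreal ((norm c)\<^sup>2) * emeasure lborel ((\<lambda>z. b + c * z) -` S) = emeasure lborel S"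
  by (subst (2) lborel_complex_affine[OF assms(1), of b])
    (simp add: emeasure_density emeasure_distr nn_integral_cmult_indicator)

lemma continuous_henon: "continuous_on UNIV (henon P c)"
  unfolding henon_def case_prod_unfold by (intro continuous_intros)

text \<open>Fubini: for fixed \<open>w\<close> the map carries the line of second coordinate
  \<open>w\<close> to the line of first coordinate \<open>w\<close> by an affine map with factor
  \<open>c\<close>, so each slice scales in the same way.\<close>

lemma emeasure_henon_vimage:
  assumes c: "c \<noteq> 0" and S: "S \<in> sets borel"
  shows "ennreal ((norm c)\<^sup>2) * emeasure lborel (henon P c -` S) = emeasure lborel S"
proof -
  have S' [measurable]: "S \<in> sets (lborel \<Otimes>\<^sub>M lborel)" using S by (subst lborel_prod) simp
  have [measurable]: "henon P c \<in> borel \<rightarrow>\<^sub>M borel"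
    by (rule borel_measurable_continuous_onI[OF continuous_henon])
  have "henon P c -` S \<in> sets borel"
    using measurable_sets[OF \<open>henon P c \<in> _\<close> S] by simp
  then have T [measurable]: "henon P c -` S \<in> sets (lborel \<Otimes>\<^sub>M lborel)" by (subst lborel_prod) simp
  have sec: "Pair w -` S \<in> sets borel" for w
    using sets_Pair1[OF S', of w] by simp
  have "ennreal ((norm c)\<^sup>2) * emeasure lborel (henon P c -` S)
      = ennreal ((norm c)\<^sup>2) * (\<integral>\<^sup>+ w. emeasure lborel ((\<lambda>z. (z, w)) -` (henon P c -` S)) \<partial>lborel)"
    using lborel_pair.emeasure_pair_measure_alt2[OF T] by (simp add: lborel_prod)
  also have "\<dots> = (\<integral>\<^sup>+ w. ennreal ((norm c)\<^sup>2) * emeasure lborel ((\<lambda>z. (z, w)) -` (henon P c -` S)) \<partial>lborel)"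
    by (rule nn_integral_cmult[symmetric]) (rule lborel_pair.measurable_emeasure_Pair2[OF T])
  also have "\<dots> = (\<integral>\<^sup>+ w. emeasure lborel (Pair w -` S) \<partial>lborel)"
  proof (rule nn_integral_cong)
    fix w
    have "(\<lambda>z. (z, w)) -` (henon P c -` S) = (\<lambda>z. poly P w + c * z) -` (Pair w -` S)"
      by (auto simp: henon_def)
    then show "ennreal ((norm c)\<^sup>2) * emeasure lborel ((\<lambda>z. (z, w)) -` (henon P c -` S))
        = emeasure lborel (Pair w -` S)"
      using emeasure_lborel_complex_affine_vimage[OF c sec] by simp
  qed
  also have "\<dots> = emeasure lborel S"
    using lborel.emeasure_pair_measure_alt[OF S'] by (simp add: lborel_prod)
  finally show ?thesis .
qed

section \<open>Compositions of Henon maps and their inverses\<close>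

lemma henon_comp_Nil [simp]: "henon_comp [] = id"
  by (simp add: henon_comp_def)

lemma henon_comp_Cons [simp]: "henon_comp ((P, c) # gs) = henon P c \<circ> henon_comp gs"
  by (simp add: henon_comp_def)

definition henon_inv :: "complex poly \<Rightarrow> complex \<Rightarrow> complex \<times> complex \<Rightarrow> complex \<times> complex" where
  "henon_inv P c = (\<lambda>(z, w). ((w - poly P z) / c, z))"

lemma bij_henon: "c \<noteq> 0 \<Longrightarrow> bij (henon P c)"
  and inv_henon: "c \<noteq> 0 \<Longrightarrow> inv (henon P c) = henon_inv P c"
proof -
  assume c: "c \<noteq> 0"
  have 1: "henon P c (henon_inv P c p) = p" for p
    using c by (simp add: henon_def henon_inv_def case_prod_unfold)
  have 2: "henon_inv P c (henon P c p) = p" for p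
    using c by (simp add: henon_def henon_inv_def case_prod_unfold)
  show "bij (henon P c)" by (metis 1 2 bijI')
  show "inv (henon P c) = henon_inv P c"
    by (rule inv_equality) (use 1 2 in auto)
qed

lemma bij_henon_comp: "\<forall>(P, c)\<in>set gs. c \<noteq> 0 \<Longrightarrow> bij (henon_comp gs)"
proof (induction gs)
  case (Cons h gs)
  obtain P c where h: "h = (P, c)" by (cases h)
  have "bij (henon P c \<circ> henon_comp gs)"
    using Cons h by (intro bij_comp bij_henon) auto
  then show ?case unfolding h henon_comp_Cons .
qed simp

lemma C1_map_henon_inv:
  assumes "c \<noteq> 0"
  shows "C1_map (henon_inv P c)"
proof -
  define f' where "f' = (\<lambda>p::complex \<times> complex.
    Blinfun (\<lambda>h. ((snd h - poly (pderiv P) (fst p) * fst h) / c, fst h)))"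
  have lin: "bounded_linear (\<lambda>h::complex \<times> complex. ((snd h - t * fst h) / c, fst h))" for t
    by (intro bounded_linear_Pair bounded_linear_fst bounded_linear_sub bounded_linear_snd
        bounded_linear_compose[OF bounded_linear_divide] bounded_linear_compose[OF bounded_linear_mult_right])
  have f': "blinfun_apply (f' p) = (\<lambda>h. ((snd h - poly (pderiv P) (fst p) * fst h) / c, fst h))" for p
    unfolding f'_def by (rule bounded_linear_Blinfun_apply[OF lin])
  have "(henon_inv P c has_derivative blinfun_apply (f' p)) (at p)" for p
  proof -
    have "(poly P has_derivative (\<lambda>h. poly (pderiv P) (fst p) * h)) (at (fst p))"
      using poly_DERIV[of P "fst p"] by (simp add: has_field_derivative_def)
    then have "((\<lambda>q. poly P (fst q)) has_derivative (\<lambda>h. poly (pderiv P) (fst p) * fst h)) (at p)"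
      using has_derivative_compose[OF has_derivative_fst[OF has_derivative_ident]] by blast
    then show ?thesis
      unfolding f' henon_inv_def case_prod_unfold
      by (auto intro!: derivative_eq_intros simp: assms field_simps)
  qed
  moreover have "continuous_on UNIV f'"
    \<comment> \<open>In finite dimension, operator-norm continuity can be checked on basis
      vectors.\<close>
    by (rule continuous_on_blinfun_componentwise) (use assms in \<open>auto simp: f' intro!: continuous_intros\<close>)
  ultimately show ?thesis unfolding C1_map_def by blast
qed

lemma C1_map_inv_henon_comp:
  "\<forall>(P, c)\<in>set gs. c \<noteq> 0 \<Longrightarrow> C1_map (inv (henon_comp gs))"
proof (induction gs)
  case (Cons h gs)
  obtain P c where h: "h = (P, c)" by (cases h)
  have "inv (henon P c \<circ> henon_comp gs) = inv (henon_comp gs) \<circ> henon_inv P c"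
    using Cons.prems h by (subst o_inv_distrib) (auto intro: bij_henon bij_henon_comp simp: inv_henon)
  moreover have "C1_map (inv (henon_comp gs) \<circ> henon_inv P c)"
    using Cons h by (intro C1_map_comp C1_map_henon_inv) auto
  ultimately show ?case unfolding h henon_comp_Cons by (simp only:)
qed (simp add: C1_map_id)

lemma emeasure_henon_comp_vimage:
  assumes "\<forall>(P, c)\<in>set gs. c \<noteq> 0" "S \<in> sets borel"
  shows "ennreal ((norm (prod_list (map snd gs)))\<^sup>2) * emeasure lborel (henon_comp gs -` S) = emeasure lborel S"
  using assms
proof (induction gs arbitrary: S)
  case (Cons h gs)
  obtain P c where h: "h = (P, c)" by (cases h)
  have hS: "henon P c -` S \<in> sets borel"
    using measurable_sets_borel[OF borel_measurable_continuous_onI[OF continuous_henon] Cons.prems(2)] .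
  have "henon_comp (h # gs) -` S = henon_comp gs -` (henon P c -` S)"
    by (simp add: h vimage_comp)
  moreover have "ennreal ((norm (prod_list (map snd (h # gs))))\<^sup>2)
      = ennreal ((norm c)\<^sup>2) * ennreal ((norm (prod_list (map snd gs)))\<^sup>2)"
    by (simp add: h norm_mult power_mult_distrib ennreal_mult)
  ultimately show ?case
    using Cons.IH[OF _ hS] Cons.prems emeasure_henon_vimage[of c S P] h
    by (simp add: mult.assoc del: henon_comp_Cons)
qed simp

section \<open>Existence of bounded orbits\<close>

text \<open>For large \<open>R\<close> this is the forward-invariant piece of the usual filtration
  for Henon maps, where the top power of \<open>w\<close> dominates.\<close>

definition escape :: "real \<Rightarrow> (complex \<times> complex) set" where
  "escape R = {(z, w). R < norm w \<and> norm z \<le> norm w}"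

definition bidisc :: "real \<Rightarrow> (complex \<times> complex) set" where
  "bidisc R = cball 0 R \<times> cball 0 R"

lemma compact_bidisc: "compact (bidisc R)"
  unfolding bidisc_def by (intro compact_Times compact_cball)

text \<open>Write the polynomial as \<open>b + w * q\<close> with \<open>q\<close> nonconstant, and
  go far enough out that \<open>q\<close> exceeds \<open>M + 1\<close>; the spare multiple of
  \<open>norm w\<close> absorbs \<open>b\<close>.\<close>

lemma poly_superlinear:
  fixes P :: "complex poly"
  assumes "degree P \<ge> 2"
  obtains R where "R \<ge> 0" "\<And>w::complex. R < norm w \<Longrightarrow> M * norm w \<le> norm (poly P w)"
proof -
  obtain b q where P: "P = pCons b q" by (cases P)
  obtain b' q' where q: "q = pCons b' q'" by (cases q)
  have "q' \<noteq> 0" using assms P q by (auto split: if_splits)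
  then obtain r where r: "\<And>z. r \<le> norm z \<Longrightarrow> M + 1 \<le> norm (poly q z)"
    using poly_infinity[of q' "M + 1" b'] q by blast
  show ?thesis
  proof
    show "max r (norm b) \<ge> 0" by (simp add: le_max_iff_disj)
    fix w :: complex assume w: "max r (norm b) < norm w"
    have "(M + 1) * norm w \<le> norm (poly q w) * norm w"
      using r w by (intro mult_right_mono) auto
    also have "\<dots> = norm (w * poly q w)" by (simp add: norm_mult)
    also have "\<dots> \<le> norm (poly P w) + norm b"
      using norm_triangle_ineq4[of "poly P w" b] by (simp add: P)
    finally show "M * norm w \<le> norm (poly P w)" using w by (simp add: algebra_simps)
  qed
qed

text \<open>Both clauses survive composition, hence iteration. The growth of the second coordinate
  is recorded as well, since it later shows that a polynomial is nonconstant.\<close>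

definition escape_radius :: "(complex \<times> complex \<Rightarrow> complex \<times> complex) \<Rightarrow> real \<Rightarrow> bool" where
  "escape_radius g R \<longleftrightarrow>
     (\<forall>p\<in>escape R. g p \<in> escape R \<and> norm (snd p) \<le> norm (snd (g p))) \<and>
     (\<forall>p\<in>bidisc R. g p \<in> bidisc R \<union> escape R)"

lemma escape_radius_comp: "escape_radius f R \<Longrightarrow> escape_radius g R \<Longrightarrow> escape_radius (f \<circ> g) R"
  unfolding escape_radius_def by (auto intro: order_trans)

lemma escape_radius_funpow: "escape_radius g R \<Longrightarrow> escape_radius (g ^^ n) R"
proof (induction n)
  case 0
  show ?case by (simp add: escape_radius_def)
next
  case (Suc n)
  then have "escape_radius (g \<circ> g ^^ n) R" by (intro escape_radius_comp) auto
  then show ?case by (simp only: funpow.simps)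
qed

lemma escape_radius_henon:
  assumes "\<And>w. R < norm w \<Longrightarrow> (1 + norm c) * norm w \<le> norm (poly P w)"
  shows "escape_radius (henon P c) R"
proof -
  have grow: "norm w \<le> norm (poly P w + c * z)" if "R < norm w" "norm z \<le> norm w" for z w
  proof -
    have "norm (poly P w) \<le> norm (poly P w + c * z) + norm c * norm z"
      using norm_triangle_ineq4[of "poly P w + c * z" "c * z"] by (simp add: norm_mult)
    moreover have "norm c * norm z \<le> norm c * norm w"
      using that by (intro mult_left_mono) auto
    ultimately show ?thesis using assms[OF that(1)] by (simp add: algebra_simps)
  qed
  \<comment> \<open>An image of a point of the bidisc has first coordinate at most \<open>R\<close>
    in modulus, so if its second coordinate exceeds \<open>R\<close> it also dominates the
    first.\<close>
  show ?thesis
    unfolding escape_radius_def escape_def bidisc_def henon_def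
    using grow by (force)
qed

lemma henon_comp_escape_radius:
  assumes "\<forall>(P, c)\<in>set gs. degree P \<ge> 2"
  obtains R where "R \<ge> 0" "escape_radius (henon_comp gs) R"
proof -
  have "\<exists>R\<ge>0. \<forall>(P, c)\<in>set gs. \<forall>w. R < norm w \<longrightarrow> (1 + norm c) * norm w \<le> norm (poly P w)"
    using assms
  proof (induction gs)
    case (Cons h gs)
    obtain P c where h: "h = (P, c)" by (cases h)
    obtain R1 where "R1 \<ge> 0" "\<And>w. R1 < norm w \<Longrightarrow> (1 + norm c) * norm w \<le> norm (poly P w)"
      using poly_superlinear[of P "1 + norm c"] Cons.prems h by auto
    moreover obtain R2 where "R2 \<ge> 0"
      "\<forall>(P, c)\<in>set gs. \<forall>w. R2 < norm w \<longrightarrow> (1 + norm c) * norm w \<le> norm (poly P w)"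
      using Cons by auto
    ultimately show ?case
      by (intro exI[of _ "max R1 R2"]) (auto simp: h)
  qed (auto intro: exI[of _ 0])
  then obtain R where R: "R \<ge> 0"
    "\<forall>(P, c)\<in>set gs. \<forall>w. R < norm w \<longrightarrow> (1 + norm c) * norm w \<le> norm (poly P w)" by blast
  have "escape_radius (henon_comp gs) R" using R(2)
  proof (induction gs)
    case Nil
    show ?case by (simp add: escape_radius_def)
  next
    case (Cons h gs)
    obtain P c where h: "h = (P, c)" by (cases h)
    have "escape_radius (henon P c) R" using Cons.prems h by (intro escape_radius_henon) auto
    then show ?case unfolding h henon_comp_Cons using Cons by (intro escape_radius_comp) auto
  qed
  with R(1) that show ?thesis by blast
qed

section \<open>Bounded orbit segments from zeros of polynomials\<close>

lemma henon_comp_poly: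
  "\<exists>u v. \<forall>w. henon_comp gs (poly p w, poly q w) = (poly u w, poly v w)"
proof (induction gs)
  case (Cons h gs)
  obtain P c where h: "h = (P, c)" by (cases h)
  obtain u v where uv: "\<And>w. henon_comp gs (poly p w, poly q w) = (poly u w, poly v w)"
    using Cons by blast
  show ?case
    by (rule exI[of _ v], rule exI[of _ "pcompose P v + smult c u"])
      (simp add: h henon_def uv poly_pcompose)
qed auto

lemma henon_comp_funpow_poly:
  "\<exists>u v. \<forall>w. (henon_comp gs ^^ n) (0, w) = (poly u w, poly v w)"
proof (induction n)
  case 0
  show ?case by (rule exI[of _ 0], rule exI[of _ "[:0, 1:]"]) simp
next
  case (Suc n)
  then obtain u v where "\<And>w. (henon_comp gs ^^ n) (0, w) = (poly u w, poly v w)" by blast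
  then show ?case using henon_comp_poly[of gs u v] by simp
qed

text \<open>By the fundamental theorem of algebra some orbit starting on the line \<open>z = 0\<close> has second
  coordinate \<open>0\<close> at time \<open>n\<close>; it cannot have entered the escape region before.\<close>

lemma henon_comp_bounded_segment:
  assumes R: "R \<ge> 0" and esc: "escape_radius (henon_comp gs) R"
  shows "\<exists>p. \<forall>k\<le>n. (henon_comp gs ^^ k) p \<in> bidisc R"
proof -
  let ?g = "henon_comp gs"
  note esc' = escape_radius_funpow[OF esc, unfolded escape_radius_def]
  obtain u v where uv: "\<And>w. (?g ^^ n) (0, w) = (poly u w, poly v w)"
    using henon_comp_funpow_poly by blast
  have big: "norm w \<le> norm (poly v w)" if "R < norm w" for w
  proof -
    have "(0, w) \<in> escape R" using that by (simp add: escape_def)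
    then show ?thesis using esc'[of n] uv[of w] by fastforce
  qed
  have "\<not> constant (poly v)"
  proof
    assume "constant (poly v)"
    \<comment> \<open>A point outside radius \<open>R\<close> whose modulus also exceeds that of the
      supposed constant value, contradicting \<open>big\<close>.\<close>
    define x where "x = complex_of_real (R + norm (poly v 0) + 1)"
    have x: "norm x = R + norm (poly v 0) + 1"
      unfolding x_def using R by (subst norm_of_real) simp
    have "poly v x = poly v 0" using \<open>constant (poly v)\<close> unfolding constant_def by blast
    moreover have "R < norm x" unfolding x using norm_ge_zero[of "poly v 0"] by linarith
    ultimately show False using big[of x] R x by simp
  qed
  then obtain w where w: "poly v w = 0" using fundamental_theorem_of_algebra by blast
  have start: "(0, w) \<in> bidisc R \<union> escape R"
    using R by (auto simp: bidisc_def escape_def)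
  have "(?g ^^ k) (0, w) \<in> bidisc R" if "k \<le> n" for k
  proof (rule ccontr)
    assume "(?g ^^ k) (0, w) \<notin> bidisc R"
    then have "(?g ^^ k) (0, w) \<in> escape R" using esc'[of k] start by blast
    then have "(?g ^^ (n - k)) ((?g ^^ k) (0, w)) \<in> escape R" using esc'[of "n - k"] by blast
    moreover have "(?g ^^ (n - k)) ((?g ^^ k) (0, w)) = (?g ^^ n) (0, w)"
      using that funpow_add[of "n - k" k ?g] by simp
    ultimately have "(?g ^^ n) (0, w) \<in> escape R" by simp
    then show False using uv[of w] w R by (simp add: escape_def)
  qed
  then show ?thesis by blast
qed

section \<open>Two-sided bounded orbits by compactness\<close>

lemma continuous_on_henon_comp: "continuous_on UNIV (henon_comp gs)"
proof (induction gs)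
  case Nil
  show ?case by (simp add: id_def)
next
  case (Cons h gs)
  obtain P c where h: "h = (P, c)" by (cases h)
  have "continuous_on UNIV (henon P c \<circ> henon_comp gs)"
    by (intro continuous_on_compose Cons continuous_on_subset[OF continuous_henon]) auto
  then show ?case unfolding h henon_comp_Cons .
qed

lemma continuous_on_funpow:
  fixes f :: "'a::topological_space \<Rightarrow> 'a"
  shows "continuous_on UNIV f \<Longrightarrow> continuous_on UNIV (f ^^ n)"
proof (induction n)
  case (Suc n)
  then have "continuous_on UNIV (f \<circ> f ^^ n)"
    using continuous_on_subset[OF Suc.prems] by (intro continuous_on_compose) auto
  then show ?case by (simp only: funpow.simps)
qed (simp add: id_def)

text \<open>The midpoint of an orbit segment of length \<open>2 n\<close> in the bidisc has
  \<open>n\<close> steps of past and of future there. The compact sets of such points are nested and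
  nonempty, and a common point has bounded orbit in both directions.\<close>

lemma bounded_orbits_nonempty:
  assumes data: "\<forall>(P, c)\<in>set gs. degree P \<ge> 2 \<and> c \<noteq> 0"
    and cont: "continuous_on UNIV (inv (henon_comp gs))"
  shows "Kplus (henon_comp gs) \<inter> Kminus (henon_comp gs) \<noteq> {}"
proof -
  let ?g = "henon_comp gs"
  obtain R where R: "R \<ge> 0" "escape_radius ?g R"
    using henon_comp_escape_radius[of gs] data by blast
  have bij: "bij ?g" by (rule bij_henon_comp) (use data in auto)
  define F where "F = (\<lambda>n. {p. \<forall>k\<le>n. (?g ^^ k) p \<in> bidisc R \<and> (inv ?g ^^ k) p \<in> bidisc R})"
  have F_eq: "F n = bidisc R \<inter> (\<Inter>k\<in>{..n}. (?g ^^ k) -` bidisc R \<inter> (inv ?g ^^ k) -` bidisc R)" for n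
    by (auto simp: F_def intro: spec[where x = 0])
  have cl: "closed ((?g ^^ k) -` bidisc R)" "closed ((inv ?g ^^ k) -` bidisc R)" for k
    by (intro closed_vimage compact_imp_closed[OF compact_bidisc] continuous_on_funpow
        continuous_on_henon_comp cont)+
  have "compact (F n)" for n
    unfolding F_eq using cl by (intro compact_Int_closed compact_bidisc closed_INT) auto
  moreover have "F n \<noteq> {}" for n
  proof -
    obtain q where q: "\<And>k. k \<le> n + n \<Longrightarrow> (?g ^^ k) q \<in> bidisc R"
      using henon_comp_bounded_segment[OF R, of "n + n"] by blast
    have "(?g ^^ k) ((?g ^^ n) q) \<in> bidisc R" if "k \<le> n" for k
      using q[of "k + n"] that by (simp add: funpow_add)
    moreover have "(inv ?g ^^ k) ((?g ^^ n) q) \<in> bidisc R" if "k \<le> n" for k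
    proof -
      have "(?g ^^ n) q = (?g ^^ k) ((?g ^^ (n - k)) q)"
        using that funpow_add[of k "n - k" ?g] by simp
      then have "(inv ?g ^^ k) ((?g ^^ n) q) = (?g ^^ (n - k)) q"
        using bij by (simp add: inv_fn_o_fn_is_id[THEN fun_cong, unfolded o_def])
      then show ?thesis using q[of "n - k"] by simp
    qed
    ultimately have "(?g ^^ n) q \<in> F n" by (simp add: F_def)
    then show ?thesis by blast
  qed
  moreover have "F n \<subseteq> F m" if "m \<le> n" for m n
    using that by (auto simp: F_def)
  ultimately have "\<Inter> (range F) \<noteq> {}" by (intro compact_nest) auto
  then obtain p where "\<And>n. p \<in> F n" by blast
  then have "(?g ^^ k) p \<in> bidisc R" "(inv ?g ^^ k) p \<in> bidisc R" for k by (auto simp: F_def)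
  then have "p \<in> Kplus ?g" "p \<in> Kminus ?g"
    unfolding Kplus_def Kminus_def
    by (auto intro: bounded_subset[OF compact_imp_bounded[OF compact_bidisc[of R]]])
  then show ?thesis by blast
qed

section \<open>Dimension bound\<close>

text \<open>The points whose whole backward orbit stays in a fixed ball form a set of finite volume which
  is contained in its preimage under the inverse map; hence it is a null set.\<close>

lemma interior_Kminus_empty:
  fixes g :: "'a::euclidean_space \<Rightarrow> 'a"
  assumes cont: "continuous_on UNIV (inv g)" and \<rho>: "0 \<le> \<rho>" "\<rho> < 1"
    and vol: "\<And>S. S \<in> sets borel \<Longrightarrow> emeasure lborel (inv g -` S) = ennreal \<rho> * emeasure lborel S"
  shows "interior (Kminus g) = {}"
proof -
  \<comment> \<open>Integer radii make this a countable exhaustion of \<open>Kminus g\<close>, so it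
    suffices that each piece is null.\<close>
  define T where "T = (\<lambda>M::nat. {p. \<forall>n. (inv g ^^ n) p \<in> cball 0 (real M)})"
  have T_closed: "closed (T M)" for M
  proof -
    have "T M = (\<Inter>n. (inv g ^^ n) -` cball 0 (real M))" by (auto simp: T_def)
    then show ?thesis
      by (simp add: closed_INT closed_vimage continuous_on_funpow[OF cont])
  qed
  have null: "T M \<in> null_sets lborel" for M
  proof -
    have borel: "T M \<in> sets borel" using T_closed by (rule borel_closed)
    have "T M \<subseteq> cball 0 (real M)"
      by (auto simp: T_def dest: spec[where x = 0])
    then have fin: "emeasure lborel (T M) < \<infinity>"
      by (intro emeasure_bounded_finite bounded_subset[OF bounded_cball])
    have "T M \<subseteq> inv g -` T M"
    proof
      fix p assume p: "p \<in> T M"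
      have "(inv g ^^ n) (inv g p) = (inv g ^^ Suc n) p" for n
        by (simp add: funpow_swap1)
      moreover have "(inv g ^^ Suc n) p \<in> cball 0 (real M)" for n
        using p unfolding T_def by blast
      ultimately show "p \<in> inv g -` T M" unfolding T_def by simp
    qed
    moreover have "inv g -` T M \<in> sets borel"
      using measurable_sets_borel[OF borel_measurable_continuous_onI[OF cont] borel] .
    ultimately have le: "emeasure lborel (T M) \<le> ennreal \<rho> * emeasure lborel (T M)"
      using vol[OF borel] emeasure_mono[of "T M" "inv g -` T M" lborel] by simp
    define m where "m = measure lborel (T M)"
    have m: "emeasure lborel (T M) = ennreal m" "m \<ge> 0"
      using fin by (auto simp: m_def emeasure_eq_ennreal_measure)
    have "m \<le> \<rho> * m" using le m \<rho> by (simp add: ennreal_mult'[symmetric])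
    then have "m * (1 - \<rho>) \<le> 0" by (simp add: algebra_simps)
    then have "m = 0" using \<rho> m(2) by (simp add: mult_le_0_iff)
    then show ?thesis using m borel by (simp add: null_setsI)
  qed
  have sub: "Kminus g \<subseteq> (\<Union>M. T M)"
  proof
    fix p assume "p \<in> Kminus g"
    then obtain B where B: "\<And>n. norm ((inv g ^^ n) p) \<le> B"
      unfolding Kminus_def bounded_iff by auto
    have "norm ((inv g ^^ n) p) \<le> real (nat \<lceil>B\<rceil>)" for n
      using B[of n] by linarith
    then have "p \<in> T (nat \<lceil>B\<rceil>)" by (simp add: T_def)
    then show "p \<in> (\<Union>M. T M)" by blast
  qed
  have UN_null: "(\<Union>M. T M) \<in> null_sets lborel" using null by (intro null_sets_UN) auto
  show ?thesis
  proof (rule ccontr)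
    assume "interior (Kminus g) \<noteq> {}"
    then obtain p where "p \<in> interior (Kminus g)" by blast
    then obtain r where "r > 0" and ball: "ball p r \<subseteq> Kminus g" unfolding mem_interior by blast
    have "ball p r \<subseteq> (\<Union>M. T M)" using ball sub by (rule subset_trans)
    then have "ball p r \<in> null_sets lborel" by (intro null_sets_subset[OF UN_null]) simp_all
    moreover have "0 < unit_ball_vol (real DIM('a)) * r ^ DIM('a)" using \<open>r > 0\<close> by simp
    ultimately show False using \<open>r > 0\<close> by (simp add: null_sets_def emeasure_ball)
  qed
qed

theorem theorem5p2:
  fixes d :: nat and gs :: "(complex poly \<times> complex) list"
    and g :: "complex \<times> complex \<Rightarrow> complex \<times> complex"
    and a :: complex and V :: "(complex \<times> complex) set" and s :: real
  assumes "d \<ge> 2" and "henon_data d gs" and "g = henon_comp gs"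
    and "a = prod_list (map snd gs)"
    and "norm a < 1"
    and "compact V"
    and "Kplus g \<inter> Kminus g \<subseteq> interior V"
    and "g ` (Jplus g \<inter> V) \<subseteq> Jplus g \<inter> V"
    and "inv g ` (Jminus g \<inter> V) \<subseteq> Jminus g \<inter> V"
    and "s = lim (\<lambda>n. (1 / real n) *
           ln (SUP p \<in> Jminus g \<inter> V. onorm (frechet_derivative (inv g ^^ n) (at p))))"
  shows "upper_box_dim (Kminus g \<inter> V) \<le> ereal (4 - 2 * ln (1 / norm a) / s)
       \<and> 4 - 2 * ln (1 / norm a) / s < 4"
proof -
  have data: "\<forall>(P, c)\<in>set gs. degree P \<ge> 2 \<and> c \<noteq> 0"
    and nonzero: "\<forall>(P, c)\<in>set gs. c \<noteq> 0"
    using assms(2) by (auto simp: henon_data_def)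
  have a: "a \<noteq> 0" unfolding assms(4) using nonzero by (auto simp: prod_list_zero_iff)
  have bij: "bij g" unfolding assms(3) by (rule bij_henon_comp[OF nonzero])
  have C1: "C1_map (inv g)" unfolding assms(3) by (rule C1_map_inv_henon_comp[OF nonzero])
  have cont: "continuous_on UNIV (inv g)" by (rule C1_map_continuous[OF C1])
  have vol: "emeasure lborel (inv g -` S) = ennreal ((norm a)\<^sup>2) * emeasure lborel S"
    if "S \<in> sets borel" for S
  proof -
    have "inv g -` S \<in> sets borel"
      using measurable_sets_borel[OF borel_measurable_continuous_onI[OF cont] that] .
    \<comment> \<open>The law for \<open>g\<close> is applied to the preimage of \<open>S\<close>
      under the inverse, whose own preimage under \<open>g\<close> is \<open>S\<close>.\<close>
    then have "ennreal ((norm a)\<^sup>2) * emeasure lborel (g -` (inv g -` S)) = emeasure lborel (inv g -` S)"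
      unfolding assms(3,4) by (rule emeasure_henon_comp_vimage[OF nonzero])
    moreover have "g -` (inv g -` S) = S" using bij by (simp add: vimage_comp bij_is_inj)
    ultimately show ?thesis by simp
  qed
  have a2: "0 < (norm a)\<^sup>2" "(norm a)\<^sup>2 < 1"
    using a assms(5) by (auto simp: power_less_one_iff)
  have "interior (Kminus g) = {}"
    by (rule interior_Kminus_empty[OF cont _ a2(2) vol]) simp
  \<comment> \<open>Without interior, the frontier is the whole closure.\<close>
  then have sub: "Kminus g \<subseteq> Jminus g"
    unfolding Jminus_def frontier_def using closure_subset by auto
  have "Kplus g \<inter> Kminus g \<noteq> {}"
    unfolding assms(3) by (rule bounded_orbits_nonempty[OF data cont[unfolded assms(3)]])
  then have ne: "Kminus g \<inter> V \<noteq> {}" using assms(7) interior_subset by blast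
  interpret volume_expanding "inv g" "Jminus g \<inter> V" "(norm a)\<^sup>2"
  proof
    show "compact (Jminus g \<inter> V)"
      unfolding Jminus_def by (intro closed_Int_compact frontier_closed assms(6))
    show "Jminus g \<inter> V \<noteq> {}" using ne sub by blast
  qed (use C1 vol a2 assms(9) in auto)
  have s: "s = rate" unfolding assms(10) rate_def growth_def ..
  \<comment> \<open>The factor 2 of the bound: the real Jacobian is the squared modulus of the
    complex one.\<close>
  have ln: "ln (1 / (norm a)\<^sup>2) = 2 * ln (1 / norm a)"
    using a by (simp add: ln_div ln_realpow)
  have "upper_box_dim (Kminus g \<inter> V) \<le> ereal (4 - 2 * ln (1 / norm a) / s)"
    using upper_box_dim_le[OF _ ne] sub unfolding ln s by auto
  moreover have "0 < 2 * ln (1 / norm a) / s"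
    using ln_inverse_rho_pos rate_pos unfolding ln s by simp
  ultimately show ?thesis by simp
qed

end
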